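(* Let $P$ be a ring and let $(\Lambda,\preceq)$ be an infinite, irreducible, locally finite proset. Then $\mathrm{M}_\Lambda(P)\cong\varprojlim_{\alpha\in\Gamma(\Lambda)}\mathrm{M}_\alpha(P)$ as rings, where for $\alpha\subset\beta$ in $\Gamma(\Lambda)$ the transition map $\mathrm{M}_\beta(P)\to\mathrm{M}_\alpha(P)$ is restriction of matrices to the entries indexed by $\alpha\times\alpha$. If moreover $P$ is a topological ring, then $\mathrm{M}_\Lambda(P)$ is a topological ring with the topology given by the inverse limit.
   Context: Rings are associative with identity and non-trivial; topological rings are Hausdorff. A proset is a preordered set. For $s_1\preceq s_2$ in a proset $\Lambda$, $[s_1,s_2]=\{s\in\Lambda: s_1\preceq s\preceq s_2\}$; $\Lambda$ is locally finite if all these intervals are finite. Put $\mathcal N_1(s)=\{t: t\preceq s\text{ or }s\preceq t\}$, $\mathcal N_n(s)=\bigcup_{t\in\mathcal N_{n-1}(s)}\mathcal N_1(t)$ for $n>1$, $\mathcal N_0(s)=[s,s]$, and $\mathcal N_\omega(s)=\bigcup_n\mathcal N_n(s)$. Two elements $s,t$ are independent if $s\notin\mathcal N_\omega(t)$. $\Lambda$ is irreducible if it is not the union of two disjoint non-empty subsets such that every element of one is independent from every element of the other (equivalently, any two elements are joined by a finite chain of consecutively comparable elements). A subset $\Lambda'\subset\Lambda$ is closed under intervals if $[s_1,s_2]\subset\Lambda'$ whenever $s_1\preceq s_2$ are in $\Lambda'$; it is convex if it is closed under intervals and for all $s_1,s_2\in\Lambda'$ there are $t_1,\dots,t_n\in\Lambda'$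 with $t_1\in\mathcal N_1(s_1)$, $t_{i+1}\in\mathcal N_1(t_i)$ for $1\le i\le n-1$, and $s_2\in\mathcal N_1(t_n)$. $\Gamma(\Lambda)$ is the set of all finite convex subsets of $\Lambda$, ordered by inclusion. For a locally finite proset $\Lambda$, the incidence ring is $\mathrm{M}_\Lambda(P)=\{(a_{s_1,s_2})\in P^{\Lambda\times\Lambda}: a_{s_1,s_2}\neq 0\Rightarrow s_1\preceq s_2\}$ with coordinatewise addition and product $(ab)_{s_1,s_2}=\sum_{t\in[s_1,s_2]}a_{s_1,t}b_{t,s_2}$. If $P$ is a topological ring and $\alpha$ is finite, $\mathrm{M}_\alpha(P)$ has the subspace topology from the product space $P^{\alpha\times\alpha}$. *)

theory Defs
  imports "HOL-Analysis.Analysis" "HOL-Algebra.QuotRing"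
begin

section \<open>Prosets\<close>

text \<open>A proset is a carrier set together with a relation \<open>r\<close> such that
  \<open>preorder_on \<Lambda> r\<close>, where \<open>(s, t) \<in> r\<close> means \<open>s \<preceq> t\<close>. As \<open>r \<subseteq> \<Lambda> \<times> \<Lambda>\<close>,
  intervals and neighbourhoods are automatically subsets of \<open>\<Lambda>\<close>. The proset induced on a
  subset \<open>\<alpha>\<close> is \<open>(\<alpha>, Restr r \<alpha>)\<close>.\<close>

text \<open>The empty set unless \<open>s \<preceq> t\<close>.\<close>
definition interval :: "'l rel \<Rightarrow> 'l \<Rightarrow> 'l \<Rightarrow> 'l set" where
  "interval r s t = {u. (s, u) \<in> r \<and> (u, t) \<in> r}"

definition locally_finite_rel :: "'l rel \<Rightarrow> bool" where
  "locally_finite_rel r \<longleftrightarrow> (\<forall>(s, t) \<in> r. finite (interval r s t))"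

definition nbhd1 :: "'l rel \<Rightarrow> 'l \<Rightarrow> 'l set" where
  "nbhd1 r s = {t. (t, s) \<in> r \<or> (s, t) \<in> r}"

fun nbhd :: "'l rel \<Rightarrow> nat \<Rightarrow> 'l \<Rightarrow> 'l set" where
  "nbhd r 0 s = interval r s s"
| "nbhd r (Suc 0) s = nbhd1 r s"
| "nbhd r (Suc (Suc n)) s = (\<Union>t \<in> nbhd r (Suc n) s. nbhd1 r t)"

definition nbhd_omega :: "'l rel \<Rightarrow> 'l \<Rightarrow> 'l set" where
  "nbhd_omega r s = (\<Union>n. nbhd r n s)"

definition independent_elems :: "'l rel \<Rightarrow> 'l \<Rightarrow> 'l \<Rightarrow> bool" where
  "independent_elems r s t \<longleftrightarrow> s \<notin> nbhd_omega r t"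

definition irreducible_proset :: "'l set \<Rightarrow> 'l rel \<Rightarrow> bool" where
  "irreducible_proset \<Lambda> r \<longleftrightarrow>
     \<not> (\<exists>A B. \<Lambda> = A \<union> B \<and> A \<inter> B = {} \<and> A \<noteq> {} \<and> B \<noteq> {} \<and>
            (\<forall>s \<in> A. \<forall>t \<in> B. independent_elems r s t))"

definition closed_under_intervals :: "'l rel \<Rightarrow> 'l set \<Rightarrow> bool" where
  "closed_under_intervals r A \<longleftrightarrow>
     (\<forall>s \<in> A. \<forall>t \<in> A. (s, t) \<in> r \<longrightarrow> interval r s t \<subseteq> A)"

definition convex_subset :: "'l rel \<Rightarrow> 'l set \<Rightarrow> bool" where
  "convex_subset r A \<longleftrightarrow>
     closed_under_intervals r A \<and>
     (\<forall>s1 \<in> A. \<forall>s2 \<in> A. \<exists>n \<ge> 1. \<exists>t :: nat \<Rightarrow> 'l.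
        (\<forall>i \<in> {1..n}. t i \<in> A) \<and>
        t 1 \<in> nbhd1 r s1 \<and>
        (\<forall>i \<in> {1..<n}. t (i + 1) \<in> nbhd1 r (t i)) \<and>
        s2 \<in> nbhd1 r (t n))" for r :: "'l rel"

definition finite_convex_subsets :: "'l set \<Rightarrow> 'l rel \<Rightarrow> 'l set set" where
  "finite_convex_subsets \<Lambda> r = {\<alpha>. \<alpha> \<subseteq> \<Lambda> \<and> finite \<alpha> \<and> convex_subset r \<alpha>}"

definition inclusion_rel :: "'l set set \<Rightarrow> 'l set rel" where
  "inclusion_rel \<G> = {(\<alpha>, \<beta>). \<alpha> \<in> \<G> \<and> \<beta> \<in> \<G> \<and> \<alpha> \<subseteq> \<beta>}"


section \<open>Incidence rings\<close>

text \<open>A matrix over \<open>(A, r)\<close> is an extensional function on \<open>A \<times> A\<close>.\<close>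

definition incidence_ring ::
  "('a, 'm) ring_scheme \<Rightarrow> 'l set \<Rightarrow> 'l rel \<Rightarrow> ('l \<times> 'l \<Rightarrow> 'a) ring" where
  "incidence_ring P A r =
    \<lparr>carrier = {a \<in> A \<times> A \<rightarrow>\<^sub>E carrier P.
                 \<forall>s \<in> A. \<forall>t \<in> A. a (s, t) \<noteq> \<zero>\<^bsub>P\<^esub> \<longrightarrow> (s, t) \<in> r},
     mult = (\<lambda>a b. \<lambda>(s, t) \<in> A \<times> A.
               (\<Oplus>\<^bsub>P\<^esub>u \<in> interval r s t. a (s, u) \<otimes>\<^bsub>P\<^esub> b (u, t))),
     one = (\<lambda>(s, t) \<in> A \<times> A. if s = t then \<one>\<^bsub>P\<^esub> else \<zero>\<^bsub>P\<^esub>),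
     zero = (\<lambda>(s, t) \<in> A \<times> A. \<zero>\<^bsub>P\<^esub>),
     add = (\<lambda>a b. \<lambda>(s, t) \<in> A \<times> A. a (s, t) \<oplus>\<^bsub>P\<^esub> b (s, t))\<rparr>"

definition sub_incidence_ring ::
  "('a, 'm) ring_scheme \<Rightarrow> 'l rel \<Rightarrow> 'l set \<Rightarrow> ('l \<times> 'l \<Rightarrow> 'a) ring" where
  "sub_incidence_ring P r \<alpha> = incidence_ring P \<alpha> (Restr r \<alpha>)"

definition matrix_topology ::
  "('a, 'm) ring_scheme \<Rightarrow> 'a topology \<Rightarrow> 'l rel \<Rightarrow> 'l set \<Rightarrow> ('l \<times> 'l \<Rightarrow> 'a) topology" where
  "matrix_topology P T r \<alpha> =
     subtopology (product_topology (\<lambda>_. T) (\<alpha> \<times> \<alpha>)) (carrier (sub_incidence_ring P r \<alpha>))"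

text \<open>Restriction of a matrix over \<open>\<beta> \<supseteq> \<alpha>\<close> to the entries indexed by \<open>\<alpha> \<times> \<alpha>\<close>; the
  argument \<open>\<beta>\<close> only records the domain of the transition map.\<close>
definition matrix_restrict ::
  "'l set \<Rightarrow> 'l set \<Rightarrow> ('l \<times> 'l \<Rightarrow> 'a) \<Rightarrow> ('l \<times> 'l \<Rightarrow> 'a)" where
  "matrix_restrict \<alpha> \<beta> a = restrict a (\<alpha> \<times> \<alpha>)"


section \<open>Nontrivial and topological rings\<close>

definition nontrivial_ring :: "('a, 'm) ring_scheme \<Rightarrow> bool" where
  "nontrivial_ring R \<longleftrightarrow> ring R \<and> \<one>\<^bsub>R\<^esub> \<noteq> \<zero>\<^bsub>R\<^esub>"

definition topological_ring :: "('a, 'm) ring_scheme \<Rightarrow> 'a topology \<Rightarrow> bool" where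
  "topological_ring R T \<longleftrightarrow>
     nontrivial_ring R \<and> topspace T = carrier R \<and> Hausdorff_space T \<and>
     continuous_map (prod_topology T T) T (\<lambda>(x, y). x \<oplus>\<^bsub>R\<^esub> y) \<and>
     continuous_map T T (\<lambda>x. \<ominus>\<^bsub>R\<^esub> x) \<and>
     continuous_map (prod_topology T T) T (\<lambda>(x, y). x \<otimes>\<^bsub>R\<^esub> y)"


section \<open>Inverse limits\<close>

text \<open>\<open>f i j\<close> is the transition map from the \<open>j\<close>-th to the \<open>i\<close>-th ring, for \<open>(i, j) \<in> D\<close>.
  The rings are allowed to be trivial, as the matrix ring over the empty set is.\<close>

definition inverse_system_rings ::
  "'i set \<Rightarrow> 'i rel \<Rightarrow> ('i \<Rightarrow> ('a, 'm) ring_scheme) \<Rightarrow> ('i \<Rightarrow> 'i \<Rightarrow> 'a \<Rightarrow> 'a) \<Rightarrow> bool" where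
  "inverse_system_rings I D R f \<longleftrightarrow>
     partial_order_on I D \<and> I \<noteq> {} \<and>
     (\<forall>i \<in> I. \<forall>j \<in> I. \<exists>k \<in> I. (i, k) \<in> D \<and> (j, k) \<in> D) \<and>
     (\<forall>i \<in> I. ring (R i)) \<and>
     (\<forall>(i, j) \<in> D. f i j \<in> ring_hom (R j) (R i)) \<and>
     (\<forall>i \<in> I. \<forall>x \<in> carrier (R i). f i i x = x) \<and>
     (\<forall>i j k. (i, j) \<in> D \<longrightarrow> (j, k) \<in> D \<longrightarrow>
        (\<forall>x \<in> carrier (R k). f i j (f j k x) = f i k x))"

definition inverse_limit_set ::
  "'i set \<Rightarrow> 'i rel \<Rightarrow> ('i \<Rightarrow> 'a set) \<Rightarrow> ('i \<Rightarrow> 'i \<Rightarrow> 'a \<Rightarrow> 'a) \<Rightarrow> ('i \<Rightarrow> 'a) set" where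
  "inverse_limit_set I D C f =
     {x \<in> (\<Pi>\<^sub>E i \<in> I. C i). \<forall>(i, j) \<in> D. f i j (x j) = x i}"

definition inverse_limit_ring ::
  "'i set \<Rightarrow> 'i rel \<Rightarrow> ('i \<Rightarrow> ('a, 'm) ring_scheme) \<Rightarrow> ('i \<Rightarrow> 'i \<Rightarrow> 'a \<Rightarrow> 'a) \<Rightarrow> ('i \<Rightarrow> 'a) ring"
where
  "inverse_limit_ring I D R f =
    \<lparr>carrier = inverse_limit_set I D (\<lambda>i. carrier (R i)) f,
     mult = (\<lambda>x y. \<lambda>i \<in> I. x i \<otimes>\<^bsub>R i\<^esub> y i),
     one = (\<lambda>i \<in> I. \<one>\<^bsub>R i\<^esub>),
     zero = (\<lambda>i \<in> I. \<zero>\<^bsub>R i\<^esub>),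
     add = (\<lambda>x y. \<lambda>i \<in> I. x i \<oplus>\<^bsub>R i\<^esub> y i)\<rparr>"

definition inverse_limit_topology ::
  "'i set \<Rightarrow> 'i rel \<Rightarrow> ('i \<Rightarrow> 'a topology) \<Rightarrow> ('i \<Rightarrow> 'i \<Rightarrow> 'a \<Rightarrow> 'a) \<Rightarrow> ('i \<Rightarrow> 'a) topology" where
  "inverse_limit_topology I D X f =
     subtopology (product_topology X I) (inverse_limit_set I D (\<lambda>i. topspace (X i)) f)"

text \<open>The canonical map from matrices over \<open>\<Lambda>\<close> into the product of the matrix rings over
  the members of \<open>\<G>\<close>.\<close>
definition restriction_family ::
  "'l set set \<Rightarrow> ('l \<times> 'l \<Rightarrow> 'a) \<Rightarrow> ('l set \<Rightarrow> 'l \<times> 'l \<Rightarrow> 'a)" where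
  "restriction_family \<G> a = (\<lambda>\<alpha> \<in> \<G>. restrict a (\<alpha> \<times> \<alpha>))"

end

theory Submission
  imports Defs
begin

text \<open>Irreducibility joins any two elements of \<open>\<Lambda>\<close> by a finite chain of comparable elements, so
  every finite subset lies in a finite connected set \<open>C\<close>. The union of all intervals with endpoints
  in \<open>C\<close> is finite by local finiteness, closed under intervals by transitivity, and still connected;
  hence every finite subset lies in a member of \<open>\<Gamma>(\<Lambda>)\<close>. Consequently \<open>\<Gamma>(\<Lambda>)\<close> is directed, and the
  \<open>(s, t)\<close> entry of a matrix over \<open>\<Lambda>\<close> can be read off any \<open>\<alpha> \<in> \<Gamma>(\<Lambda>)\<close> containing \<open>s\<close> and \<open>t\<close>, which
  makes restriction to the finite convex sets bijective. It is multiplicative because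
  \<open>[s, t] \<subseteq> \<alpha>\<close> whenever \<open>s, t \<in> \<alpha>\<close>. For the same reasons the inverse limit topology is the topology of
  entrywise convergence, in which products are continuous as each entry of a product is a finite sum.\<close>

section \<open>Finite convex subsets\<close>

text \<open>Local finiteness speaks only of pairs in \<open>r\<close>. For any other pair
  transitivity leaves the interval empty.\<close>

lemma locally_finite_rel_finite_interval:
  assumes "locally_finite_rel r" "trans r"
  shows "finite (interval r s t)"
proof (cases "(s, t) \<in> r")
  case True
  then show ?thesis using assms(1) by (auto simp: locally_finite_rel_def)
next
  case False
  then have "interval r s t = {}" using assms(2) by (auto simp: interval_def dest: transD)
  then show ?thesis by simp
qed

text \<open>Each neighbourhood step is one comparability. This inclusion suffices below, since
  independence is proved by showing that an element lies outside all neighbourhoods.\<close>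

lemma nbhd_subset_rtrancl: "nbhd r n s \<subseteq> (r \<union> r\<inverse>)\<^sup>* `` {s}"
proof (induction r n s rule: nbhd.induct)
  case (1 r s)
  then show ?case by (auto simp: interval_def)
next
  case (2 r s)
  then show ?case by (auto simp: nbhd1_def)
next
  case (3 r n s)
  then show ?case by (fastforce simp: nbhd1_def intro: rtrancl_into_rtrancl)
qed

text \<open>Otherwise the connected component of \<open>s\<close> and its complement would split
  \<Lambda> into two nonempty independent parts.\<close>

lemma irreducible_proset_rtrancl:
  assumes "irreducible_proset \<Lambda> r" "r \<subseteq> \<Lambda> \<times> \<Lambda>" "s \<in> \<Lambda>" "t \<in> \<Lambda>"
  shows "(s, t) \<in> (r \<union> r\<inverse>)\<^sup>*"
proof (rule ccontr)
  assume st: "(s, t) \<notin> (r \<union> r\<inverse>)\<^sup>*"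
  define A where "A = {u \<in> \<Lambda>. (s, u) \<in> (r \<union> r\<inverse>)\<^sup>*}"
  have sym: "sym ((r \<union> r\<inverse>)\<^sup>*)" by (intro sym_rtrancl sym_Un_converse)
  have "independent_elems r u v" if "u \<in> A" "v \<in> \<Lambda> - A" for u v
  proof -
    have "(u, v) \<notin> (r \<union> r\<inverse>)\<^sup>*" using that by (auto simp: A_def intro: rtrancl_trans)
    then have "(v, u) \<notin> (r \<union> r\<inverse>)\<^sup>*" using sym by (auto dest: symD)
    then show ?thesis
      using nbhd_subset_rtrancl[of r _ v] by (fastforce simp: independent_elems_def nbhd_omega_def)
  qed
  moreover have "s \<in> A" "t \<in> \<Lambda> - A" "\<Lambda> = A \<union> (\<Lambda> - A)" using assms st by (auto simp: A_def)
  ultimately show False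
    using assms(1) unfolding irreducible_proset_def by (metis Diff_disjoint empty_iff)
qed

text \<open>Replaces the indexed chains of \<open>convex_subset\<close> by paths inside
  \<open>A\<close>, which compose more easily. Induction on a path builds the chain.\<close>

lemma convex_subsetI:
  assumes closed: "closed_under_intervals r A"
    and refl: "refl_on A r"
    and conn: "\<And>s t. s \<in> A \<Longrightarrow> t \<in> A \<Longrightarrow> (s, t) \<in> (Restr (r \<union> r\<inverse>) A)\<^sup>*"
  shows "convex_subset r A"
proof -
  have "\<exists>n\<ge>1. \<exists>t :: nat \<Rightarrow> 'a. (\<forall>i \<in> {1..n}. t i \<in> A) \<and> t 1 \<in> nbhd1 r s1 \<and>
        (\<forall>i \<in> {1..<n}. t (i + 1) \<in> nbhd1 r (t i)) \<and> s2 \<in> nbhd1 r (t n)"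
    if s1: "s1 \<in> A" and path: "(s1, s2) \<in> (Restr (r \<union> r\<inverse>) A)\<^sup>*" for s1 s2
    using path
  proof (induction rule: rtrancl_induct)
    case base
    show ?case
      \<comment> \<open>A chain must have at least one intermediate point, so the trivial path
        becomes the one-term chain \<open>s1\<close>, comparable to itself by reflexivity.\<close>
      by (rule exI[of _ 1]) (use s1 refl in \<open>auto simp: nbhd1_def refl_on_def intro!: exI[of _ "\<lambda>_. s1"]\<close>)
  next
    case (step y z)
    then obtain n :: nat and t where n: "n \<ge> 1" "\<forall>i \<in> {1..n}. t i \<in> A" "t 1 \<in> nbhd1 r s1"
      "\<forall>i \<in> {1..<n}. t (i + 1) \<in> nbhd1 r (t i)" "y \<in> nbhd1 r (t n)" by blast
    have "y \<in> A" "z \<in> nbhd1 r y" using step.hyps by (auto simp: nbhd1_def)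
    \<comment> \<open>The former endpoint \<open>y\<close> becomes the last intermediate point, and
      \<open>z\<close> the new endpoint.\<close>
    define t' where "t' = t(Suc n := y)"
    have t': "t' (Suc n) = y" "\<And>i. i \<le> n \<Longrightarrow> t' i = t i" by (auto simp: t'_def)
    have "\<forall>i \<in> {1..Suc n}. t' i \<in> A" using n(2) t' \<open>y \<in> A\<close> by (auto simp: le_Suc_eq)
    moreover have "t' 1 \<in> nbhd1 r s1" using n(1,3) t'(2)[of 1] by simp
    moreover have "\<forall>i \<in> {1..<Suc n}. t' (i + 1) \<in> nbhd1 r (t' i)"
    proof
      fix i assume i: "i \<in> {1..<Suc n}"
      show "t' (i + 1) \<in> nbhd1 r (t' i)"
      proof (cases "i = n")
        case True
        then show ?thesis using n(5) t' by simp
      next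
        case False
        then show ?thesis using i n(4) t'(2)[of i] t'(2)[of "i + 1"] by simp
      qed
    qed
    moreover have "z \<in> nbhd1 r (t' (Suc n))" using \<open>z \<in> nbhd1 r y\<close> t' by simp
    ultimately show ?case using n(1) by (metis le_SucI)
  qed
  with closed conn show ?thesis unfolding convex_subset_def by blast
qed

text \<open>A path visits finitely many points, so each point of \<open>F\<close> lies in a finite
  set connected to \<open>c\<close> from within. Measuring connectedness from a fixed base point
  makes it survive unions.\<close>

lemma ex_finite_connected_superset:
  assumes conn: "\<And>t. t \<in> \<Lambda> \<Longrightarrow> (c, t) \<in> (r \<union> r\<inverse>)\<^sup>*" and r: "r \<subseteq> \<Lambda> \<times> \<Lambda>"
    and c: "c \<in> \<Lambda>" and F: "finite F" "F \<subseteq> \<Lambda>"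
  shows "\<exists>C. finite C \<and> F \<subseteq> C \<and> C \<subseteq> \<Lambda> \<and> (\<forall>y\<in>C. (c, y) \<in> (Restr (r \<union> r\<inverse>) C)\<^sup>*)"
proof -
  \<comment> \<open>A path inside a set stays a path inside any larger set.\<close>
  have mono: "(Restr (r \<union> r\<inverse>) C)\<^sup>* \<subseteq> (Restr (r \<union> r\<inverse>) D)\<^sup>*" if "C \<subseteq> D" for C D
    by (rule rtrancl_mono) (use that in auto)
  have path: "\<exists>C. finite C \<and> c \<in> C \<and> x \<in> C \<and> C \<subseteq> \<Lambda> \<and> (\<forall>y\<in>C. (c, y) \<in> (Restr (r \<union> r\<inverse>) C)\<^sup>*)"
    if "(c, x) \<in> (r \<union> r\<inverse>)\<^sup>*" for x
    using that
  proof (induction rule: rtrancl_induct)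
    case base
    show ?case by (rule exI[of _ "{c}"]) (use c in auto)
  next
    case (step y z)
    then obtain C where C: "finite C" "c \<in> C" "y \<in> C" "C \<subseteq> \<Lambda>"
      "\<forall>u\<in>C. (c, u) \<in> (Restr (r \<union> r\<inverse>) C)\<^sup>*" by blast
    \<comment> \<open>The set for \<open>y\<close> already contains a path from \<open>c\<close> to
      \<open>y\<close>; adding \<open>z\<close> makes room for the last edge.\<close>
    let ?D = "insert z C"
    have D: "(c, u) \<in> (Restr (r \<union> r\<inverse>) ?D)\<^sup>*" if "u \<in> C" for u
      using that C(5) mono[of C ?D] by blast
    have "(y, z) \<in> Restr (r \<union> r\<inverse>) ?D" using step.hyps C by auto
    then have "(c, z) \<in> (Restr (r \<union> r\<inverse>) ?D)\<^sup>*" using D[OF C(3)] by (rule rtrancl_into_rtrancl[rotated])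
    then show ?case using C D step.hyps r by (intro exI[of _ ?D]) auto
  qed
  show ?thesis
    using F
  proof (induction F)
    case empty
    show ?case by (rule exI[of _ "{}"]) auto
  next
    case (insert x F)
    then obtain C where C: "finite C" "F \<subseteq> C" "C \<subseteq> \<Lambda>"
      "\<forall>u\<in>C. (c, u) \<in> (Restr (r \<union> r\<inverse>) C)\<^sup>*" by auto
    obtain D where D: "finite D" "x \<in> D" "D \<subseteq> \<Lambda>" "\<forall>u\<in>D. (c, u) \<in> (Restr (r \<union> r\<inverse>) D)\<^sup>*"
      using path[OF conn[of x]] insert.prems by auto
    have "\<forall>u\<in>C \<union> D. (c, u) \<in> (Restr (r \<union> r\<inverse>) (C \<union> D))\<^sup>*"
      using C(4) D(4) mono[of C "C \<union> D"] mono[of D "C \<union> D"] by blast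
    then show ?case using C D by (intro exI[of _ "C \<union> D"]) auto
  qed
qed

lemma ex_finite_convex_superset:
  assumes pre: "preorder_on \<Lambda> r" and irr: "irreducible_proset \<Lambda> r"
    and fin: "locally_finite_rel r" and F: "finite F" "F \<subseteq> \<Lambda>"
  shows "\<exists>\<alpha> \<in> finite_convex_subsets \<Lambda> r. F \<subseteq> \<alpha>"
proof (cases "\<Lambda> = {}")
  case True
  \<comment> \<open>There is no base point here, but the empty set is vacuously convex.\<close>
  then have "F = {}" using F by simp
  then show ?thesis
    by (intro bexI[of _ "{}"])
      (auto simp: finite_convex_subsets_def convex_subset_def closed_under_intervals_def)
next
  case False
  then obtain c where c: "c \<in> \<Lambda>" by blast
  have r: "r \<subseteq> \<Lambda> \<times> \<Lambda>" "refl_on \<Lambda> r" "trans r" using pre by (auto simp: preorder_on_def)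
  let ?R = "r \<union> r\<inverse>"
  obtain C where C: "finite C" "F \<subseteq> C" "C \<subseteq> \<Lambda>" "\<forall>y\<in>C. (c, y) \<in> (Restr ?R C)\<^sup>*"
    using ex_finite_connected_superset[OF irreducible_proset_rtrancl[OF irr r(1) c] r(1) c F] by blast
  \<comment> \<open>The interval hull of \<open>C\<close>. Forming it once is enough: from s
    \<preceq> u \<preceq> w \<preceq> v \<preceq> t with \<open>s\<close>, \<open>t\<close> in
    \<open>C\<close>, any \<open>w\<close> between elements of \<open>H\<close> already lies in an
    interval with endpoints in \<open>C\<close>.\<close>
  define H where "H = (\<Union>s\<in>C. \<Union>t\<in>C. interval r s t)"
  have "finite H" unfolding H_def
    using C(1) locally_finite_rel_finite_interval[OF fin r(3)] by blast
  have "C \<subseteq> H" using C(3) r(2) by (fastforce simp: H_def interval_def refl_on_def)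
  have "H \<subseteq> \<Lambda>" using r(1) by (auto simp: H_def interval_def)
  have mono: "(Restr ?R C)\<^sup>* \<subseteq> (Restr ?R H)\<^sup>*" by (rule rtrancl_mono) (use \<open>C \<subseteq> H\<close> in auto)
  have "closed_under_intervals r H"
    unfolding closed_under_intervals_def
  proof (intro ballI impI subsetI)
    fix u v w assume "u \<in> H" "v \<in> H" "w \<in> interval r u v"
    then obtain s t where "s \<in> C" "t \<in> C" "(s, u) \<in> r" "(v, t) \<in> r" "(u, w) \<in> r" "(w, v) \<in> r"
      by (auto simp: H_def interval_def)
    then have "s \<in> C" "t \<in> C" "w \<in> interval r s t"
      using r(3) by (auto simp: interval_def dest: transD)
    then show "w \<in> H" by (auto simp: H_def)
  qed
  moreover have "refl_on H r" using r(2) \<open>H \<subseteq> \<Lambda>\<close> by (auto simp: refl_on_def)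
  moreover have "(u, v) \<in> (Restr ?R H)\<^sup>*" if "u \<in> H" "v \<in> H" for u v
  proof -
    \<comment> \<open>Every \<open>u\<close> in \<open>H\<close> lies above some \<open>s\<close> in
      \<open>C\<close>; a path from \<open>c\<close> to \<open>s\<close> inside \<open>C\<close>
      followed by this one comparability reaches \<open>u\<close>.\<close>
    have "(c, u) \<in> (Restr ?R H)\<^sup>*" if "u \<in> H" for u
    proof -
      obtain s where s: "s \<in> C" "(s, u) \<in> r" using \<open>u \<in> H\<close> by (auto simp: H_def interval_def)
      then have "(s, u) \<in> Restr ?R H" using that \<open>C \<subseteq> H\<close> by auto
      moreover have "(c, s) \<in> (Restr ?R H)\<^sup>*" using s(1) C(4) mono by blast
      ultimately show ?thesis by (rule rtrancl_into_rtrancl[rotated])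
    qed
    moreover have "sym ((Restr ?R H)\<^sup>*)" by (intro sym_rtrancl) (auto simp: sym_def)
    ultimately show ?thesis using that by (meson rtrancl_trans symD)
  qed
  ultimately have "convex_subset r H" by (rule convex_subsetI)
  then show ?thesis
    using \<open>finite H\<close> \<open>H \<subseteq> \<Lambda>\<close> \<open>C \<subseteq> H\<close> C(2) unfolding finite_convex_subsets_def by blast
qed

section \<open>The incidence ring\<close>

text \<open>Fubini for finite sums, by induction on \<open>A\<close>; it carries the associativity
  of the matrix product.\<close>

lemma (in abelian_monoid) finsum_swap:
  assumes "finite A" "finite B" "\<And>i j. i \<in> A \<Longrightarrow> j \<in> B \<Longrightarrow> f i j \<in> carrier G"
  shows "(\<Oplus>i\<in>A. \<Oplus>j\<in>B. f i j) = (\<Oplus>j\<in>B. \<Oplus>i\<in>A. f i j)"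
  using assms(1,3)
proof (induction A)
  case empty
  then show ?case by (simp add: finsum_zero)
next
  case (insert a A)
  then have "(\<Oplus>i\<in>insert a A. \<Oplus>j\<in>B. f i j) = (\<Oplus>j\<in>B. f a j) \<oplus> (\<Oplus>j\<in>B. \<Oplus>i\<in>A. f i j)"
    by (simp add: finsum_insert finsum_closed Pi_def)
  also have "\<dots> = (\<Oplus>j\<in>B. f a j \<oplus> (\<Oplus>i\<in>A. f i j))"
    using insert.prems by (subst finsum_addf) (auto intro!: finsum_closed)
  also have "\<dots> = (\<Oplus>j\<in>B. \<Oplus>i\<in>insert a A. f i j)"
    using insert by (intro finsum_cong') (auto simp: finsum_insert intro!: finsum_closed)
  finally show ?case .
qed

section \<open>Entries and supports of incidence matrices\<close>

lemma incidence_ring_mult_apply: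
  assumes "s \<in> A" "t \<in> A"
  shows "(a \<otimes>\<^bsub>incidence_ring P A r\<^esub> b) (s, t) =
    (\<Oplus>\<^bsub>P\<^esub>u \<in> interval r s t. a (s, u) \<otimes>\<^bsub>P\<^esub> b (u, t))"
  using assms by (simp add: incidence_ring_def)

lemma incidence_ring_add_apply:
  assumes "s \<in> A" "t \<in> A"
  shows "(a \<oplus>\<^bsub>incidence_ring P A r\<^esub> b) (s, t) = a (s, t) \<oplus>\<^bsub>P\<^esub> b (s, t)"
  using assms by (simp add: incidence_ring_def)

lemma incidence_ring_one_apply:
  assumes "s \<in> A" "t \<in> A"
  shows "\<one>\<^bsub>incidence_ring P A r\<^esub> (s, t) = (if s = t then \<one>\<^bsub>P\<^esub> else \<zero>\<^bsub>P\<^esub>)"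
  using assms by (simp add: incidence_ring_def)

lemma incidence_ring_zero_apply:
  assumes "s \<in> A" "t \<in> A"
  shows "\<zero>\<^bsub>incidence_ring P A r\<^esub> (s, t) = \<zero>\<^bsub>P\<^esub>"
  using assms by (simp add: incidence_ring_def)

lemmas incidence_ring_apply =
  incidence_ring_mult_apply incidence_ring_add_apply incidence_ring_one_apply incidence_ring_zero_apply

lemma incidence_ring_carrierI:
  assumes "a \<in> extensional (A \<times> A)"
    and "\<And>s t. s \<in> A \<Longrightarrow> t \<in> A \<Longrightarrow> a (s, t) \<in> carrier P"
    and "\<And>s t. s \<in> A \<Longrightarrow> t \<in> A \<Longrightarrow> (s, t) \<notin> r \<Longrightarrow> a (s, t) = \<zero>\<^bsub>P\<^esub>"
  shows "a \<in> carrier (incidence_ring P A r)"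
  using assms by (auto simp: incidence_ring_def PiE_def)

lemma incidence_ring_carrierD:
  assumes "a \<in> carrier (incidence_ring P A r)"
  shows "a \<in> extensional (A \<times> A)"
    and "\<And>s t. s \<in> A \<Longrightarrow> t \<in> A \<Longrightarrow> a (s, t) \<in> carrier P"
    and "\<And>s t. s \<in> A \<Longrightarrow> t \<in> A \<Longrightarrow> (s, t) \<notin> r \<Longrightarrow> a (s, t) = \<zero>\<^bsub>P\<^esub>"
  using assms by (auto simp: incidence_ring_def PiE_def)

lemma incidence_ring_eqI:
  assumes "a \<in> carrier (incidence_ring P A r)" "b \<in> carrier (incidence_ring P A r)"
    and "\<And>s t. s \<in> A \<Longrightarrow> t \<in> A \<Longrightarrow> a (s, t) = b (s, t)"
  shows "a = b"
  by (rule extensionalityI[OF incidence_ring_carrierD(1)[OF assms(1)] incidence_ring_carrierD(1)[OF assms(2)]])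
    (use assms(3) in auto)

text \<open>Stated for an arbitrary locally finite proset, so that it applies to \<Lambda> as well
  as to its subsets with the induced order.\<close>

locale incidence = ring P for P :: "('a, 'm) ring_scheme" (structure) +
  fixes A :: "'l set" and r :: "'l rel"
  assumes preorder: "preorder_on A r"
    and locally_finite: "locally_finite_rel r"
begin

abbreviation "M \<equiv> incidence_ring P A r"

lemma rel_subset: "r \<subseteq> A \<times> A" and rel_refl: "s \<in> A \<Longrightarrow> (s, s) \<in> r" and rel_trans: "trans r"
  using preorder by (auto simp: preorder_on_def refl_on_def)

lemma interval_subset: "interval r s t \<subseteq> A"
  using rel_subset by (auto simp: interval_def)

lemma interval_empty: "(s, t) \<notin> r \<Longrightarrow> interval r s t = {}"
  using rel_trans by (auto simp: interval_def dest: transD)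

lemma finite_interval: "finite (interval r s t)"
  using locally_finite rel_trans by (rule locally_finite_rel_finite_interval)

section \<open>Ring axioms for the incidence ring\<close>

lemma finsum_mult_closed:
  assumes "a \<in> carrier M" "b \<in> carrier M" "s \<in> A" "t \<in> A" "B \<subseteq> A"
  shows "(\<Oplus>u\<in>B. a (s, u) \<otimes> b (u, t)) \<in> carrier P"
  using incidence_ring_carrierD(2)[OF assms(1,3)] incidence_ring_carrierD(2)[OF assms(2) _ assms(4)] assms(5)
  by (intro finsum_closed) blast

text \<open>The support condition holds because a pair outside \<open>r\<close> has an empty
  interval, hence an empty sum as its entry.\<close>

lemma mult_closed: "a \<in> carrier M \<Longrightarrow> b \<in> carrier M \<Longrightarrow> a \<otimes>\<^bsub>M\<^esub> b \<in> carrier M"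
  by (rule incidence_ring_carrierI)
    (auto simp: incidence_ring_apply finsum_mult_closed interval_subset interval_empty,
     simp add: incidence_ring_def)

lemma add_closed: "a \<in> carrier M \<Longrightarrow> b \<in> carrier M \<Longrightarrow> a \<oplus>\<^bsub>M\<^esub> b \<in> carrier M"
  by (rule incidence_ring_carrierI)
    (auto simp: incidence_ring_apply incidence_ring_carrierD(2,3),
     simp add: incidence_ring_def)

lemma one_closed_incidence: "\<one>\<^bsub>M\<^esub> \<in> carrier M"
  by (rule incidence_ring_carrierI)
    (auto simp: incidence_ring_apply rel_refl, simp add: incidence_ring_def)

lemma zero_closed_incidence: "\<zero>\<^bsub>M\<^esub> \<in> carrier M"
  by (rule incidence_ring_carrierI)
    (auto simp: incidence_ring_apply, simp add: incidence_ring_def)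

lemma uminus_closed: "a \<in> carrier M \<Longrightarrow> (\<lambda>(s, t) \<in> A \<times> A. \<ominus> a (s, t)) \<in> carrier M"
  by (rule incidence_ring_carrierI) (auto simp: incidence_ring_carrierD(2,3))

text \<open>For \<open>u\<close> outside the interval, \<open>a (s, u)\<close> or
  \<open>b (u, t)\<close> vanishes by the support condition. Enlarging the index set only adds
  zeros, and this gives nested sums a common index set.\<close>

lemma mult_apply_superset:
  assumes "a \<in> carrier M" "b \<in> carrier M" "s \<in> A" "t \<in> A"
    and "interval r s t \<subseteq> B" "B \<subseteq> A" "finite B"
  shows "(a \<otimes>\<^bsub>M\<^esub> b) (s, t) = (\<Oplus>u\<in>B. a (s, u) \<otimes> b (u, t))"
proof -
  have "a (s, u) \<otimes> b (u, t) = \<zero>" if "u \<in> B - interval r s t" for u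
  proof -
    have u: "u \<in> A" "(s, u) \<notin> r \<or> (u, t) \<notin> r" using that assms(6) by (auto simp: interval_def)
    then show ?thesis
      using assms(1-4) incidence_ring_carrierD(2,3)[OF assms(1)] incidence_ring_carrierD(2,3)[OF assms(2)]
      by auto
  qed
  moreover have "a (s, u) \<otimes> b (u, t) \<in> carrier P" if "u \<in> B" for u
    using that incidence_ring_carrierD(2)[OF assms(1,3)] incidence_ring_carrierD(2)[OF assms(2) _ assms(4)]
      assms(6) by blast
  ultimately show ?thesis
    unfolding incidence_ring_mult_apply[OF assms(3,4)]
    using assms(5,7) by (intro add.finprod_mono_neutral_cong_left) auto
qed

lemma mult_assoc:
  assumes "a \<in> carrier M" "b \<in> carrier M" "c \<in> carrier M"
  shows "(a \<otimes>\<^bsub>M\<^esub> b) \<otimes>\<^bsub>M\<^esub> c = a \<otimes>\<^bsub>M\<^esub> (b \<otimes>\<^bsub>M\<^esub> c)"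
proof (rule incidence_ring_eqI)
  fix s t assume st: "s \<in> A" "t \<in> A"
  let ?I = "interval r s t"
  note cl = incidence_ring_carrierD(2)[OF assms(1)] incidence_ring_carrierD(2)[OF assms(2)]
    incidence_ring_carrierD(2)[OF assms(3)]
  have I: "u \<in> ?I \<Longrightarrow> u \<in> A" for u using interval_subset by blast
  \<comment> \<open>By transitivity the intervals of both inner products lie in [s, t], so both
    iterated products become double sums over one fixed square, where the order of summation can be
    exchanged.\<close>
  have sub: "interval r s u \<subseteq> ?I" "interval r u t \<subseteq> ?I" if "u \<in> ?I" for u
    using that rel_trans by (auto simp: interval_def dest: transD)
  have ab: "(a \<otimes>\<^bsub>M\<^esub> b) (s, u) = (\<Oplus>v\<in>?I. a (s, v) \<otimes> b (v, u))" if "u \<in> ?I" for u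
    using assms(1,2) st(1) I[OF that] sub(1)[OF that] interval_subset finite_interval
    by (rule mult_apply_superset)
  have bc: "(b \<otimes>\<^bsub>M\<^esub> c) (u, t) = (\<Oplus>v\<in>?I. b (u, v) \<otimes> c (v, t))" if "u \<in> ?I" for u
    using assms(2,3) I[OF that] st(2) sub(2)[OF that] interval_subset finite_interval
    by (rule mult_apply_superset)
  have "((a \<otimes>\<^bsub>M\<^esub> b) \<otimes>\<^bsub>M\<^esub> c) (s, t) = (\<Oplus>u\<in>?I. (\<Oplus>v\<in>?I. a (s, v) \<otimes> b (v, u)) \<otimes> c (u, t))"
    unfolding incidence_ring_mult_apply[OF st]
    using st I cl by (intro finsum_cong') (auto simp: ab intro!: finsum_closed)
  also have "\<dots> = (\<Oplus>u\<in>?I. \<Oplus>v\<in>?I. a (s, v) \<otimes> b (v, u) \<otimes> c (u, t))"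
    using st I cl by (intro finsum_cong' finsum_ldistr) (auto simp: finite_interval intro!: finsum_closed)
  also have "\<dots> = (\<Oplus>v\<in>?I. \<Oplus>u\<in>?I. a (s, v) \<otimes> b (v, u) \<otimes> c (u, t))"
    using st I cl by (intro finsum_swap) (auto simp: finite_interval)
  also have "\<dots> = (\<Oplus>v\<in>?I. \<Oplus>u\<in>?I. a (s, v) \<otimes> (b (v, u) \<otimes> c (u, t)))"
    using st I cl by (intro finsum_cong') (auto simp: m_assoc intro!: finsum_closed)
  also have "\<dots> = (\<Oplus>v\<in>?I. a (s, v) \<otimes> (\<Oplus>u\<in>?I. b (v, u) \<otimes> c (u, t)))"
    using st I cl
    by (intro finsum_cong' finsum_rdistr[symmetric])
      (auto simp: finite_interval intro!: finsum_closed)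
  also have "\<dots> = (a \<otimes>\<^bsub>M\<^esub> (b \<otimes>\<^bsub>M\<^esub> c)) (s, t)"
    unfolding incidence_ring_mult_apply[OF st]
    using st I cl by (intro finsum_cong') (auto simp: bc intro!: finsum_closed)
  finally show "((a \<otimes>\<^bsub>M\<^esub> b) \<otimes>\<^bsub>M\<^esub> c) (s, t) = (a \<otimes>\<^bsub>M\<^esub> (b \<otimes>\<^bsub>M\<^esub> c)) (s, t)" .
qed (use assms in \<open>auto intro: mult_closed\<close>)

lemma one_mult:
  assumes "a \<in> carrier M"
  shows "\<one>\<^bsub>M\<^esub> \<otimes>\<^bsub>M\<^esub> a = a"
proof (rule incidence_ring_eqI)
  fix s t assume st: "s \<in> A" "t \<in> A"
  note D = incidence_ring_carrierD[OF assms]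
  have I: "u \<in> interval r s t \<Longrightarrow> u \<in> A" for u using interval_subset by blast
  have "(\<one>\<^bsub>M\<^esub> \<otimes>\<^bsub>M\<^esub> a) (s, t) = (\<Oplus>u\<in>interval r s t. if s = u then a (u, t) else \<zero>)"
    unfolding incidence_ring_mult_apply[OF st]
    using st D I by (intro finsum_cong') (auto simp: incidence_ring_apply)
  also have "\<dots> = a (s, t)"
  \<comment> \<open>The Kronecker delta selects the term at \<open>s\<close>, which belongs to the
    interval exactly when s \<preceq> t; otherwise the sum is empty and \<open>a (s, t)\<close> is
    zero.\<close>
  proof (cases "(s, t) \<in> r")
    case True
    then have "s \<in> interval r s t" using st by (auto simp: interval_def rel_refl)
    then show ?thesis using finsum_singleton[of s "interval r s t" "\<lambda>u. a (u, t)"] st D I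
      by (auto simp: finite_interval)
  next
    case False
    then show ?thesis using st D by (simp add: interval_empty)
  qed
  finally show "(\<one>\<^bsub>M\<^esub> \<otimes>\<^bsub>M\<^esub> a) (s, t) = a (s, t)" .
qed (use assms in \<open>auto intro: mult_closed one_closed_incidence\<close>)

lemma mult_one:
  assumes "a \<in> carrier M"
  shows "a \<otimes>\<^bsub>M\<^esub> \<one>\<^bsub>M\<^esub> = a"
proof (rule incidence_ring_eqI)
  fix s t assume st: "s \<in> A" "t \<in> A"
  note D = incidence_ring_carrierD[OF assms]
  have I: "u \<in> interval r s t \<Longrightarrow> u \<in> A" for u using interval_subset by blast
  have "(a \<otimes>\<^bsub>M\<^esub> \<one>\<^bsub>M\<^esub>) (s, t) = (\<Oplus>u\<in>interval r s t. if t = u then a (s, u) else \<zero>)"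
    unfolding incidence_ring_mult_apply[OF st]
    using st D I by (intro finsum_cong') (auto simp: incidence_ring_apply)
  also have "\<dots> = a (s, t)"
  proof (cases "(s, t) \<in> r")
    case True
    then have "t \<in> interval r s t" using st by (auto simp: interval_def rel_refl)
    then show ?thesis using finsum_singleton[of t "interval r s t" "\<lambda>u. a (s, u)"] st D I
      by (auto simp: finite_interval)
  next
    case False
    then show ?thesis using st D by (simp add: interval_empty)
  qed
  finally show "(a \<otimes>\<^bsub>M\<^esub> \<one>\<^bsub>M\<^esub>) (s, t) = a (s, t)" .
qed (use assms in \<open>auto intro: mult_closed one_closed_incidence\<close>)

lemma ring_incidence: "ring M"
proof (rule ringI)
  show "abelian_group M"
  proof (rule abelian_groupI)
    fix a assume a: "a \<in> carrier M"
    show "\<exists>b\<in>carrier M. b \<oplus>\<^bsub>M\<^esub> a = \<zero>\<^bsub>M\<^esub>"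
    proof (rule bexI[OF _ uminus_closed[OF a]])
      show "(\<lambda>(s, t) \<in> A \<times> A. \<ominus> a (s, t)) \<oplus>\<^bsub>M\<^esub> a = \<zero>\<^bsub>M\<^esub>"
        using a by (intro incidence_ring_eqI[of _ P A r])
          (auto simp: incidence_ring_apply incidence_ring_carrierD(2) l_neg
            intro: add_closed uminus_closed zero_closed_incidence)
    qed
  qed (auto simp: incidence_ring_apply incidence_ring_carrierD(2) a_ac
      intro: add_closed zero_closed_incidence intro!: incidence_ring_eqI[of _ P A r])
  show "monoid M"
    by (rule monoidI) (auto intro: mult_closed one_closed_incidence mult_assoc one_mult mult_one)
next
  fix a b c assume abc: "a \<in> carrier M" "b \<in> carrier M" "c \<in> carrier M"
  note cl = incidence_ring_carrierD(2)[OF abc(1)] incidence_ring_carrierD(2)[OF abc(2)]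
    incidence_ring_carrierD(2)[OF abc(3)]
  have I: "u \<in> interval r s t \<Longrightarrow> u \<in> A" for u s t using interval_subset by blast
  show "(a \<oplus>\<^bsub>M\<^esub> b) \<otimes>\<^bsub>M\<^esub> c = a \<otimes>\<^bsub>M\<^esub> c \<oplus>\<^bsub>M\<^esub> b \<otimes>\<^bsub>M\<^esub> c"
  proof (rule incidence_ring_eqI)
    fix s t assume st: "s \<in> A" "t \<in> A"
    have "((a \<oplus>\<^bsub>M\<^esub> b) \<otimes>\<^bsub>M\<^esub> c) (s, t)
      = (\<Oplus>u\<in>interval r s t. a (s, u) \<otimes> c (u, t) \<oplus> b (s, u) \<otimes> c (u, t))"
      unfolding incidence_ring_mult_apply[OF st] using st I cl
      by (intro finsum_cong') (auto simp: incidence_ring_apply l_distr)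
    also have "\<dots> = (a \<otimes>\<^bsub>M\<^esub> c \<oplus>\<^bsub>M\<^esub> b \<otimes>\<^bsub>M\<^esub> c) (s, t)"
      unfolding incidence_ring_add_apply[OF st] incidence_ring_mult_apply[OF st] using st I cl
      by (intro finsum_addf) auto
    finally show "((a \<oplus>\<^bsub>M\<^esub> b) \<otimes>\<^bsub>M\<^esub> c) (s, t) = (a \<otimes>\<^bsub>M\<^esub> c \<oplus>\<^bsub>M\<^esub> b \<otimes>\<^bsub>M\<^esub> c) (s, t)" .
  qed (use abc in \<open>auto intro: mult_closed add_closed\<close>)
  show "c \<otimes>\<^bsub>M\<^esub> (a \<oplus>\<^bsub>M\<^esub> b) = c \<otimes>\<^bsub>M\<^esub> a \<oplus>\<^bsub>M\<^esub> c \<otimes>\<^bsub>M\<^esub> b"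
  proof (rule incidence_ring_eqI)
    fix s t assume st: "s \<in> A" "t \<in> A"
    have "(c \<otimes>\<^bsub>M\<^esub> (a \<oplus>\<^bsub>M\<^esub> b)) (s, t)
      = (\<Oplus>u\<in>interval r s t. c (s, u) \<otimes> a (u, t) \<oplus> c (s, u) \<otimes> b (u, t))"
      unfolding incidence_ring_mult_apply[OF st] using st I cl
      by (intro finsum_cong') (auto simp: incidence_ring_apply r_distr)
    also have "\<dots> = (c \<otimes>\<^bsub>M\<^esub> a \<oplus>\<^bsub>M\<^esub> c \<otimes>\<^bsub>M\<^esub> b) (s, t)"
      unfolding incidence_ring_add_apply[OF st] incidence_ring_mult_apply[OF st] using st I cl
      by (intro finsum_addf) auto
    finally show "(c \<otimes>\<^bsub>M\<^esub> (a \<oplus>\<^bsub>M\<^esub> b)) (s, t) = (c \<otimes>\<^bsub>M\<^esub> a \<oplus>\<^bsub>M\<^esub> c \<otimes>\<^bsub>M\<^esub> b) (s, t)" .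
  qed (use abc in \<open>auto intro: mult_closed add_closed\<close>)
qed

text \<open>Makes the abstract additive inverse explicit, so that continuity of negation can be
  checked on entries.\<close>

lemma uminus_eq:
  assumes "a \<in> carrier M"
  shows "\<ominus>\<^bsub>M\<^esub> a = (\<lambda>(s, t) \<in> A \<times> A. \<ominus> a (s, t))"
proof -
  interpret M: ring M by (rule ring_incidence)
  show ?thesis
    using assms by (intro M.minus_equality uminus_closed incidence_ring_eqI[of _ P A r])
      (auto simp: incidence_ring_apply incidence_ring_carrierD(2) l_neg
        intro: add_closed uminus_closed zero_closed_incidence)
qed

text \<open>Any diagonal entry separates one from zero; nonemptiness of \<open>A\<close> provides
  such an entry.\<close>

lemma nontrivial_ring_incidence:
  assumes "\<one> \<noteq> \<zero>" "A \<noteq> {}"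
  shows "nontrivial_ring M"
proof -
  obtain s where s: "s \<in> A" using assms(2) by blast
  have "\<one>\<^bsub>M\<^esub> (s, s) \<noteq> \<zero>\<^bsub>M\<^esub> (s, s)" using assms(1) s by (simp add: incidence_ring_apply)
  then show ?thesis using ring_incidence by (auto simp: nontrivial_ring_def)
qed

end

section \<open>Entrywise topology\<close>

lemma continuous_map_finsum:
  assumes "abelian_monoid R" "topspace T = carrier R"
    and add: "continuous_map (prod_topology T T) T (\<lambda>(x, y). x \<oplus>\<^bsub>R\<^esub> y)"
    and I: "finite I" "\<And>i. i \<in> I \<Longrightarrow> continuous_map X T (f i)"
  shows "continuous_map X T (\<lambda>x. \<Oplus>\<^bsub>R\<^esub>i\<in>I. f i x)"
  using I
proof (induction I)
  interpret R: abelian_monoid R by fact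
  {
    case empty
    show ?case using assms(2) by (simp add: R.finsum_empty)
  next
    case (insert j I)
    have "continuous_map X (prod_topology T T) (\<lambda>x. (f j x, \<Oplus>\<^bsub>R\<^esub>i\<in>I. f i x))"
      using insert by (intro continuous_map_pairedI) auto
    from continuous_map_compose[OF this add]
    have "continuous_map X T (\<lambda>x. f j x \<oplus>\<^bsub>R\<^esub> (\<Oplus>\<^bsub>R\<^esub>i\<in>I. f i x))"
      by (simp add: o_def)
    \<comment> \<open>Splitting off a summand requires values in the carrier, known only for
      \<open>x\<close> in the space. The two functions are therefore compared on
      \<open>topspace X\<close>.\<close>
    moreover have "f i x \<in> carrier R" if "x \<in> topspace X" "i \<in> insert j I" for i x
      using continuous_map_funspace[OF insert.prems[OF that(2)]] that(1) assms(2) by auto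
    ultimately show ?case
      using insert.hyps by (elim continuous_map_eq) (subst R.finsum_insert, auto)
  }
qed

context incidence
begin

text \<open>The topology of entrywise convergence. With \<alpha> and \<open>Restr r \<alpha>\<close>
  in place of \<open>A\<close> and \<open>r\<close> it is
  \<open>matrix_topology P T r \<alpha>\<close>.\<close>

abbreviation entry_topology :: "'a topology \<Rightarrow> ('l \<times> 'l \<Rightarrow> 'a) topology" where
  "entry_topology T \<equiv> subtopology (product_topology (\<lambda>_. T) (A \<times> A)) (carrier M)"

lemma topspace_entry_topology: "topspace T = carrier P \<Longrightarrow> topspace (entry_topology T) = carrier M"
  by (auto simp: incidence_ring_def)

text \<open>The universal property of a subspace of a product; the extensionality that the product
  demands comes from membership in the carrier.\<close>

lemma continuous_map_entry_topology_iff: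
  "continuous_map X (entry_topology T) f \<longleftrightarrow>
     f \<in> topspace X \<rightarrow> carrier M \<and> (\<forall>s\<in>A. \<forall>t\<in>A. continuous_map X T (\<lambda>x. f x (s, t)))"
  using incidence_ring_carrierD(1)[of _ P A r]
  by (auto simp: continuous_map_in_subtopology continuous_map_componentwise Pi_def)

lemma continuous_map_entry:
  assumes "s \<in> A" "t \<in> A"
  shows "continuous_map (entry_topology T) T (\<lambda>x. x (s, t))"
  using assms by (intro continuous_map_from_subtopology continuous_map_product_projection) auto

text \<open>Each entry of a sum, negative or product is a finite expression in entries of the
  arguments, and these entries depend continuously on the arguments.\<close>

lemma topological_ring_entry_topology:
  assumes T: "topological_ring P T" and A: "A \<noteq> {}"
  shows "topological_ring M (entry_topology T)"
proof -
  let ?E = "entry_topology T"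
  have top: "topspace T = carrier P" and haus: "Hausdorff_space T"
    and add: "continuous_map (prod_topology T T) T (\<lambda>(x, y). x \<oplus> y)"
    and neg: "continuous_map T T (\<lambda>x. \<ominus> x)"
    and mult: "continuous_map (prod_topology T T) T (\<lambda>(x, y). x \<otimes> y)"
    and "\<one> \<noteq> \<zero>"
    using T by (auto simp: topological_ring_def nontrivial_ring_def)
  note topE = topspace_entry_topology[OF top]
  have fst: "continuous_map (prod_topology ?E ?E) T (\<lambda>x. fst x (s, t))"
    and snd: "continuous_map (prod_topology ?E ?E) T (\<lambda>x. snd x (s, t))" if "s \<in> A" "t \<in> A" for s t
    using continuous_map_compose[OF continuous_map_fst continuous_map_entry[OF that]]
      continuous_map_compose[OF continuous_map_snd continuous_map_entry[OF that]]
    by (simp_all add: o_def)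
  have "continuous_map (prod_topology ?E ?E) ?E (\<lambda>(x, y). x \<oplus>\<^bsub>M\<^esub> y)"
    unfolding continuous_map_entry_topology_iff
  proof (intro conjI ballI)
    fix s t assume st: "s \<in> A" "t \<in> A"
    show "continuous_map (prod_topology ?E ?E) T (\<lambda>x. (case x of (x, y) \<Rightarrow> x \<oplus>\<^bsub>M\<^esub> y) (s, t))"
      using continuous_map_compose[OF continuous_map_pairedI[OF fst[OF st] snd[OF st]] add]
      by (simp add: o_def case_prod_unfold incidence_ring_add_apply[OF st])
  qed (auto simp: topE intro: add_closed)
  moreover have "continuous_map (prod_topology ?E ?E) ?E (\<lambda>(x, y). x \<otimes>\<^bsub>M\<^esub> y)"
    unfolding continuous_map_entry_topology_iff
  proof (intro conjI ballI)
    fix s t assume st: "s \<in> A" "t \<in> A"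
    have "continuous_map (prod_topology ?E ?E) T (\<lambda>x. fst x (s, u) \<otimes> snd x (u, t))"
      if "u \<in> interval r s t" for u
    proof -
      have u: "u \<in> A" using that interval_subset by blast
      show ?thesis
        using continuous_map_compose[OF continuous_map_pairedI[OF fst[OF st(1) u] snd[OF u st(2)]] mult]
        by (simp add: o_def)
    qed
    \<comment> \<open>The sum has finitely many terms by local finiteness, so it inherits continuity
      from its terms.\<close>
    then have "continuous_map (prod_topology ?E ?E) T
        (\<lambda>x. \<Oplus>u\<in>interval r s t. fst x (s, u) \<otimes> snd x (u, t))"
      by (rule continuous_map_finsum[OF abelian_monoid_axioms top add finite_interval])
    then show "continuous_map (prod_topology ?E ?E) T (\<lambda>x. (case x of (x, y) \<Rightarrow> x \<otimes>\<^bsub>M\<^esub> y) (s, t))"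
      by (simp add: case_prod_unfold incidence_ring_mult_apply[OF st])
  qed (auto simp: topE intro: mult_closed)
  moreover have "continuous_map ?E ?E (\<lambda>x. \<ominus>\<^bsub>M\<^esub> x)"
  proof (rule continuous_map_eq)
    show "continuous_map ?E ?E (\<lambda>x. \<lambda>(s, t) \<in> A \<times> A. \<ominus> x (s, t))"
      unfolding continuous_map_entry_topology_iff
    proof (intro conjI ballI)
      fix s t assume st: "s \<in> A" "t \<in> A"
      show "continuous_map ?E T (\<lambda>x. (\<lambda>(s, t) \<in> A \<times> A. \<ominus> x (s, t)) (s, t))"
        using continuous_map_compose[OF continuous_map_entry[OF st] neg] st by (simp add: o_def)
    qed (use uminus_closed in \<open>auto simp: topE\<close>)
  qed (simp only: topE uminus_eq)
  moreover have "Hausdorff_space ?E"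
    using haus by (intro Hausdorff_space_subtopology) (simp add: Hausdorff_space_product_topology)
  ultimately show ?thesis
    using nontrivial_ring_incidence[OF \<open>\<one> \<noteq> \<zero>\<close> A] topE by (simp add: topological_ring_def)
qed

end

section \<open>Restriction homomorphisms\<close>

text \<open>Closure under intervals ensures that the product formula over \<alpha> runs over the
  same indices as the one over the whole proset.\<close>

lemma interval_Restr:
  assumes "closed_under_intervals r \<alpha>" "trans r" "s \<in> \<alpha>" "t \<in> \<alpha>"
  shows "interval (Restr r \<alpha>) s t = interval r s t"
  using assms unfolding interval_def closed_under_intervals_def by (blast dest: transD)

context incidence
begin

lemma incidence_Restr:
  assumes "\<alpha> \<subseteq> A"
  shows "incidence P \<alpha> (Restr r \<alpha>)"
proof unfold_locales
  show "preorder_on \<alpha> (Restr r \<alpha>)"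
    using preorder assms by (auto simp: preorder_on_def refl_on_def trans_Restr)
  have "interval (Restr r \<alpha>) s t \<subseteq> interval r s t" for s t by (auto simp: interval_def)
  then show "locally_finite_rel (Restr r \<alpha>)"
    using finite_interval finite_subset by (fastforce simp: locally_finite_rel_def)
qed

lemma restrict_ring_hom:
  assumes "\<alpha> \<subseteq> A" "closed_under_intervals r \<alpha>"
  shows "(\<lambda>a. restrict a (\<alpha> \<times> \<alpha>)) \<in> ring_hom M (incidence_ring P \<alpha> (Restr r \<alpha>))"
proof (rule ring_hom_memI)
  interpret N: incidence P \<alpha> "Restr r \<alpha>" by (rule incidence_Restr[OF assms(1)])
  have A: "s \<in> \<alpha> \<Longrightarrow> s \<in> A" for s using assms(1) by blast
  show closed: "restrict a (\<alpha> \<times> \<alpha>) \<in> carrier N.M" if "a \<in> carrier M" for a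
    using that A by (intro incidence_ring_carrierI) (auto simp: incidence_ring_carrierD(2,3))
  show "restrict (a \<oplus>\<^bsub>M\<^esub> b) (\<alpha> \<times> \<alpha>) = restrict a (\<alpha> \<times> \<alpha>) \<oplus>\<^bsub>N.M\<^esub> restrict b (\<alpha> \<times> \<alpha>)"
    if "a \<in> carrier M" "b \<in> carrier M" for a b
    using that A by (intro incidence_ring_eqI[of _ P \<alpha> "Restr r \<alpha>"] closed N.add_closed add_closed)
      (auto simp: incidence_ring_apply)
  show "restrict \<one>\<^bsub>M\<^esub> (\<alpha> \<times> \<alpha>) = \<one>\<^bsub>N.M\<^esub>"
    using A by (intro incidence_ring_eqI[of _ P \<alpha> "Restr r \<alpha>"] closed N.one_closed_incidence one_closed_incidence)
      (auto simp: incidence_ring_apply)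
  show "restrict (a \<otimes>\<^bsub>M\<^esub> b) (\<alpha> \<times> \<alpha>) = restrict a (\<alpha> \<times> \<alpha>) \<otimes>\<^bsub>N.M\<^esub> restrict b (\<alpha> \<times> \<alpha>)"
    if ab: "a \<in> carrier M" "b \<in> carrier M" for a b
  proof (intro incidence_ring_eqI[of _ P \<alpha> "Restr r \<alpha>"] closed N.mult_closed mult_closed ab)
    fix s t assume st: "s \<in> \<alpha>" "t \<in> \<alpha>"
    \<comment> \<open>Both products now sum over one interval inside \<alpha>, where restricting the
      factors changes no entry.\<close>
    have I: "interval (Restr r \<alpha>) s t = interval r s t" "interval r s t \<subseteq> \<alpha>"
      using interval_Restr[OF assms(2) rel_trans st] N.interval_subset[of s t] by auto
    have "(\<Oplus>u\<in>interval r s t. a (s, u) \<otimes> b (u, t)) =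
      (\<Oplus>u\<in>interval r s t. restrict a (\<alpha> \<times> \<alpha>) (s, u) \<otimes> restrict b (\<alpha> \<times> \<alpha>) (u, t))"
      using st I(2) ab A by (intro finsum_cong') (auto simp: incidence_ring_carrierD(2) subset_iff)
    then show "restrict (a \<otimes>\<^bsub>M\<^esub> b) (\<alpha> \<times> \<alpha>) (s, t) =
        (restrict a (\<alpha> \<times> \<alpha>) \<otimes>\<^bsub>N.M\<^esub> restrict b (\<alpha> \<times> \<alpha>)) (s, t)"
      using st A I(1) by (simp add: incidence_ring_mult_apply)
  qed
qed

end

section \<open>The inverse limit\<close>

locale irreducible_incidence = incidence +
  assumes irreducible: "irreducible_proset A r"
begin

abbreviation "\<G> \<equiv> finite_convex_subsets A r"
abbreviation "L \<equiv> inverse_limit_ring \<G> (inclusion_rel \<G>) (sub_incidence_ring P r) matrix_restrict"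

section \<open>The directed system of finite convex subsets\<close>

lemma convex_subsets_cover: "finite F \<Longrightarrow> F \<subseteq> A \<Longrightarrow> \<exists>\<alpha>\<in>\<G>. F \<subseteq> \<alpha>"
  using ex_finite_convex_superset[OF preorder irreducible locally_finite] by blast

lemma convex_subsetsD:
  assumes "\<alpha> \<in> \<G>"
  shows "\<alpha> \<subseteq> A" "finite \<alpha>" "closed_under_intervals r \<alpha>"
  using assms by (auto simp: finite_convex_subsets_def convex_subset_def)

text \<open>The union of two convex sets may fail to be convex, so an upper bound is obtained by
  covering this finite union.\<close>

lemma convex_subsets_directed:
  assumes "\<alpha> \<in> \<G>" "\<beta> \<in> \<G>"
  shows "\<exists>\<gamma>\<in>\<G>. \<alpha> \<subseteq> \<gamma> \<and> \<beta> \<subseteq> \<gamma>"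
  using convex_subsets_cover[of "\<alpha> \<union> \<beta>"] convex_subsetsD assms by auto

lemma inverse_system_incidence:
  "inverse_system_rings \<G> (inclusion_rel \<G>) (sub_incidence_ring P r) matrix_restrict"
  unfolding inverse_system_rings_def
proof (intro conjI)
  show "partial_order_on \<G> (inclusion_rel \<G>)"
    by (auto simp: partial_order_on_def preorder_on_def inclusion_rel_def refl_on_def
        intro: transI antisymI)
  show "\<G> \<noteq> {}" using convex_subsets_cover[of "{}"] by auto
  show "\<forall>i\<in>\<G>. \<forall>j\<in>\<G>. \<exists>k\<in>\<G>. (i, k) \<in> inclusion_rel \<G> \<and> (j, k) \<in> inclusion_rel \<G>"
    using convex_subsets_directed by (fastforce simp: inclusion_rel_def)
  show "\<forall>i\<in>\<G>. ring (sub_incidence_ring P r i)"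
    using incidence.ring_incidence[OF incidence_Restr] convex_subsetsD(1)
    by (auto simp: sub_incidence_ring_def)
  show "\<forall>(\<alpha>, \<beta>)\<in>inclusion_rel \<G>.
    matrix_restrict \<alpha> \<beta> \<in> ring_hom (sub_incidence_ring P r \<beta>) (sub_incidence_ring P r \<alpha>)"
  proof clarify
    fix \<alpha> \<beta> assume "(\<alpha>, \<beta>) \<in> inclusion_rel \<G>"
    then have \<alpha>: "\<alpha> \<in> \<G>" and \<beta>: "\<beta> \<in> \<G>" and sub: "\<alpha> \<subseteq> \<beta>" by (auto simp: inclusion_rel_def)
    \<comment> \<open>The transition map is the restriction homomorphism with \<beta> as ambient
      proset; \<alpha> stays closed under intervals for the smaller relation.\<close>
    interpret N: incidence P \<beta> "Restr r \<beta>" by (rule incidence_Restr[OF convex_subsetsD(1)[OF \<beta>]])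
    have "closed_under_intervals (Restr r \<beta>) \<alpha>"
      using convex_subsetsD(3)[OF \<alpha>] by (fastforce simp: closed_under_intervals_def interval_def)
    moreover have "Restr (Restr r \<beta>) \<alpha> = Restr r \<alpha>" using sub by auto
    ultimately show "matrix_restrict \<alpha> \<beta> \<in> ring_hom (sub_incidence_ring P r \<beta>) (sub_incidence_ring P r \<alpha>)"
      using N.restrict_ring_hom[OF sub] by (simp add: sub_incidence_ring_def matrix_restrict_def[abs_def])
  qed
  show "\<forall>\<alpha>\<in>\<G>. \<forall>x\<in>carrier (sub_incidence_ring P r \<alpha>). matrix_restrict \<alpha> \<alpha> x = x"
    by (auto simp: sub_incidence_ring_def matrix_restrict_def
        intro!: extensional_restrict incidence_ring_carrierD(1))
  show "\<forall>i j k. (i, j) \<in> inclusion_rel \<G> \<longrightarrow> (j, k) \<in> inclusion_rel \<G> \<longrightarrow>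
      (\<forall>x\<in>carrier (sub_incidence_ring P r k).
        matrix_restrict i j (matrix_restrict j k x) = matrix_restrict i k x)"
    by (auto simp: matrix_restrict_def inclusion_rel_def fun_eq_iff restrict_def)
qed

lemma inverse_limit_carrier:
  "x \<in> carrier L \<longleftrightarrow> x \<in> extensional \<G> \<and>
     (\<forall>\<alpha>\<in>\<G>. x \<alpha> \<in> carrier (incidence_ring P \<alpha> (Restr r \<alpha>))) \<and>
     (\<forall>\<alpha>\<in>\<G>. \<forall>\<beta>\<in>\<G>. \<alpha> \<subseteq> \<beta> \<longrightarrow> restrict (x \<beta>) (\<alpha> \<times> \<alpha>) = x \<alpha>)"
  by (auto simp: inverse_limit_ring_def inverse_limit_set_def inclusion_rel_def matrix_restrict_def
      sub_incidence_ring_def PiE_iff)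

section \<open>The canonical map as a ring isomorphism\<close>

lemma restriction_family_ring_hom: "restriction_family \<G> \<in> ring_hom M L"
proof (rule ring_hom_memI)
  \<comment> \<open>The operations of the limit are componentwise, so each homomorphism law reduces
    to the one for restriction to a single \<alpha>.\<close>
  note hom = restrict_ring_hom[OF convex_subsetsD(1,3)]
  show "restriction_family \<G> a \<in> carrier L" if "a \<in> carrier M" for a
    unfolding inverse_limit_carrier restriction_family_def
  proof (intro conjI ballI impI)
    fix \<alpha> \<beta> assume "\<alpha> \<in> \<G>" "\<beta> \<in> \<G>" "\<alpha> \<subseteq> \<beta>"
    then show "restrict ((\<lambda>\<alpha>\<in>\<G>. restrict a (\<alpha> \<times> \<alpha>)) \<beta>) (\<alpha> \<times> \<alpha>) = (\<lambda>\<alpha>\<in>\<G>. restrict a (\<alpha> \<times> \<alpha>)) \<alpha>"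
      by (auto simp: fun_eq_iff restrict_def)
  qed (use ring_hom_closed[OF hom that] in simp_all)
  show "restriction_family \<G> (a \<otimes>\<^bsub>M\<^esub> b) = restriction_family \<G> a \<otimes>\<^bsub>L\<^esub> restriction_family \<G> b"
    if "a \<in> carrier M" "b \<in> carrier M" for a b
    using ring_hom_mult[OF hom that]
    by (auto simp: restriction_family_def inverse_limit_ring_def sub_incidence_ring_def intro!: restrict_ext)
  show "restriction_family \<G> (a \<oplus>\<^bsub>M\<^esub> b) = restriction_family \<G> a \<oplus>\<^bsub>L\<^esub> restriction_family \<G> b"
    if "a \<in> carrier M" "b \<in> carrier M" for a b
    using ring_hom_add[OF hom that]
    by (auto simp: restriction_family_def inverse_limit_ring_def sub_incidence_ring_def intro!: restrict_ext)
  show "restriction_family \<G> \<one>\<^bsub>M\<^esub> = \<one>\<^bsub>L\<^esub>"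
    using ring_hom_one[OF hom]
    by (auto simp: restriction_family_def inverse_limit_ring_def sub_incidence_ring_def intro!: restrict_ext)
qed

lemma restriction_family_inj_on: "inj_on (restriction_family \<G>) (carrier M)"
proof (rule inj_onI)
  fix a b assume ab: "a \<in> carrier M" "b \<in> carrier M"
    and eq: "restriction_family \<G> a = restriction_family \<G> b"
  show "a = b"
  proof (rule incidence_ring_eqI[OF ab])
    fix s t assume "s \<in> A" "t \<in> A"
    then obtain \<alpha> where \<alpha>: "\<alpha> \<in> \<G>" "s \<in> \<alpha>" "t \<in> \<alpha>" using convex_subsets_cover[of "{s, t}"] by auto
    have "restriction_family \<G> a \<alpha> (s, t) = restriction_family \<G> b \<alpha> (s, t)" by (simp only: eq)
    then show "a (s, t) = b (s, t)" using \<alpha> by (simp add: restriction_family_def)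
  qed
qed

text \<open>Both components are restrictions of the component at a common upper bound. Hence the
  matrix glued from a compatible family does not depend on choices.\<close>

lemma inverse_limit_entry_eq:
  assumes x: "x \<in> carrier L" and "\<alpha> \<in> \<G>" "\<beta> \<in> \<G>"
    and st: "s \<in> \<alpha>" "t \<in> \<alpha>" "s \<in> \<beta>" "t \<in> \<beta>"
  shows "x \<alpha> (s, t) = x \<beta> (s, t)"
proof -
  obtain \<gamma> where \<gamma>: "\<gamma> \<in> \<G>" "\<alpha> \<subseteq> \<gamma>" "\<beta> \<subseteq> \<gamma>" using convex_subsets_directed assms(2,3) by blast
  then have "restrict (x \<gamma>) (\<alpha> \<times> \<alpha>) = x \<alpha>" "restrict (x \<gamma>) (\<beta> \<times> \<beta>) = x \<beta>"
    using x assms(2,3) unfolding inverse_limit_carrier by blast+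
  then have "x \<alpha> (s, t) = restrict (x \<gamma>) (\<alpha> \<times> \<alpha>) (s, t)" "x \<beta> (s, t) = restrict (x \<gamma>) (\<beta> \<times> \<beta>) (s, t)"
    by simp_all
  then show ?thesis using st by simp
qed

lemma restriction_family_surj: "carrier L \<subseteq> restriction_family \<G> ` carrier M"
proof
  fix x assume x: "x \<in> carrier L"
  \<comment> \<open>Chooses for each pair of indices a member of \<open>\<G>\<close> containing
    both; the entry of the glued matrix is read off there.\<close>
  have "\<exists>c. \<forall>s\<in>A. \<forall>t\<in>A. c s t \<in> \<G> \<and> s \<in> c s t \<and> t \<in> c s t"
  proof -
    have "\<forall>s\<in>A. \<forall>t\<in>A. \<exists>\<alpha>. \<alpha> \<in> \<G> \<and> s \<in> \<alpha> \<and> t \<in> \<alpha>"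
    proof (intro ballI)
      fix s t assume "s \<in> A" "t \<in> A"
      then show "\<exists>\<alpha>. \<alpha> \<in> \<G> \<and> s \<in> \<alpha> \<and> t \<in> \<alpha>" using convex_subsets_cover[of "{s, t}"] by auto
    qed
    then show ?thesis by metis
  qed
  then obtain c where c: "\<And>s t. s \<in> A \<Longrightarrow> t \<in> A \<Longrightarrow> c s t \<in> \<G> \<and> s \<in> c s t \<and> t \<in> c s t" by blast
  define a where "a = (\<lambda>(s, t) \<in> A \<times> A. x (c s t) (s, t))"
  have xc: "x \<alpha> \<in> carrier (incidence_ring P \<alpha> (Restr r \<alpha>))" if "\<alpha> \<in> \<G>" for \<alpha>
    using x that unfolding inverse_limit_carrier by blast
  have "a \<in> carrier M"
  proof (rule incidence_ring_carrierI)
    fix s t assume st: "s \<in> A" "t \<in> A"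
    note cst = c[OF st]
    show "a (s, t) \<in> carrier P"
      using incidence_ring_carrierD(2)[OF xc[of "c s t"]] cst st by (simp add: a_def)
    show "a (s, t) = \<zero>" if "(s, t) \<notin> r"
      using incidence_ring_carrierD(3)[OF xc[of "c s t"]] cst st that by (simp add: a_def)
  qed (simp add: a_def)
  moreover have "restriction_family \<G> a = x"
  proof (rule extensionalityI[of _ \<G>])
    show "x \<in> extensional \<G>" using x unfolding inverse_limit_carrier by blast
    fix \<alpha> assume \<alpha>: "\<alpha> \<in> \<G>"
    show "restriction_family \<G> a \<alpha> = x \<alpha>"
    proof (rule extensionalityI[of _ "\<alpha> \<times> \<alpha>"])
      show "restriction_family \<G> a \<alpha> \<in> extensional (\<alpha> \<times> \<alpha>)" using \<alpha> by (simp add: restriction_family_def)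
      show "x \<alpha> \<in> extensional (\<alpha> \<times> \<alpha>)" using incidence_ring_carrierD(1)[OF xc[OF \<alpha>]] .
      fix p assume "p \<in> \<alpha> \<times> \<alpha>"
      then obtain s t where p: "p = (s, t)" "s \<in> \<alpha>" "t \<in> \<alpha>" by blast
      then have st: "s \<in> A" "t \<in> A" using convex_subsetsD(1)[OF \<alpha>] by auto
      \<comment> \<open>The entry was taken from the component at \<open>c s t\<close>; independence
        of the choice moves it to \<alpha>.\<close>
      show "restriction_family \<G> a \<alpha> p = x \<alpha> p"
        using inverse_limit_entry_eq[OF x \<alpha>, of "c s t" s t] c[OF st] \<alpha> p st
        by (simp add: restriction_family_def a_def)
    qed
  qed (simp add: restriction_family_def)
  ultimately show "x \<in> restriction_family \<G> ` carrier M" by blast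
qed

lemma restriction_family_ring_iso: "restriction_family \<G> \<in> ring_iso M L"
  using restriction_family_ring_hom restriction_family_inj_on restriction_family_surj
  by (auto simp: ring_iso_def bij_betw_def dest: ring_hom_closed)

text \<open>Both topologies live on \<open>carrier M\<close>, and the identity is continuous in each
  direction: single entries are seen by single components, and single components consist of
  entries.\<close>

lemma pullback_inverse_limit_topology:
  assumes top: "topspace T = carrier P"
  shows "pullback_topology (carrier M) (restriction_family \<G>)
      (inverse_limit_topology \<G> (inclusion_rel \<G>) (matrix_topology P T r) matrix_restrict)
    = entry_topology T" (is "pullback_topology _ ?f ?L = ?E")
proof -
  let ?X = "pullback_topology (carrier M) ?f ?L"
  have topm: "topspace (matrix_topology P T r \<alpha>) = carrier (sub_incidence_ring P r \<alpha>)" for \<alpha>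
    using top by (auto simp: matrix_topology_def sub_incidence_ring_def incidence_ring_def)
  have carrL: "inverse_limit_set \<G> (inclusion_rel \<G>) (\<lambda>\<alpha>. topspace (matrix_topology P T r \<alpha>)) matrix_restrict
      = carrier L"
    by (simp add: topm inverse_limit_ring_def)
  have topL: "topspace ?L = carrier L"
    unfolding inverse_limit_topology_def topspace_subtopology topspace_product_topology carrL
    by (auto simp: inverse_limit_ring_def inverse_limit_set_def topm)
  have f: "?f a \<in> carrier L" if "a \<in> carrier M" for a
    using ring_hom_closed[OF restriction_family_ring_hom that] .
  have topX: "topspace ?X = carrier M" using f by (auto simp: topspace_pullback_topology topL)
  have topE: "topspace ?E = carrier M" by (rule topspace_entry_topology[OF top])
  have "continuous_map ?X ?E id"
    unfolding continuous_map_entry_topology_iff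
  proof (intro conjI ballI)
    fix s t assume st: "s \<in> A" "t \<in> A"
    then obtain \<alpha> where \<alpha>: "\<alpha> \<in> \<G>" "s \<in> \<alpha>" "t \<in> \<alpha>" using convex_subsets_cover[of "{s, t}"] by auto
    have 1: "continuous_map ?L (matrix_topology P T r \<alpha>) (\<lambda>x. x \<alpha>)"
      unfolding inverse_limit_topology_def
      using \<alpha> by (intro continuous_map_from_subtopology continuous_map_product_projection)
    have 2: "continuous_map (matrix_topology P T r \<alpha>) T (\<lambda>y. y (s, t))"
      unfolding matrix_topology_def
      using \<alpha> by (intro continuous_map_from_subtopology continuous_map_product_projection) auto
    \<comment> \<open>The entry map factors as the canonical map, the projection to the component
      \<alpha>, and the entry of that component.\<close>
    have "continuous_map ?X T (\<lambda>x. ?f x \<alpha> (s, t))"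
      using continuous_map_pullback[OF continuous_map_compose[OF 1 2], of "carrier M" ?f]
      by (simp add: o_def)
    then show "continuous_map ?X T (\<lambda>x. id x (s, t))"
      using \<alpha> by (simp add: restriction_family_def)
  qed (simp add: topX)
  moreover have "continuous_map ?E ?X id"
  \<comment> \<open>Continuity into the pullback is continuity after the canonical map, tested
    component by component and then, within each \<alpha>, entry by entry.\<close>
  proof (rule continuous_map_pullback')
    have "continuous_map ?E (matrix_topology P T r \<alpha>) (\<lambda>x. ?f x \<alpha>)" if \<alpha>: "\<alpha> \<in> \<G>" for \<alpha>
    proof -
      interpret N: incidence P \<alpha> "Restr r \<alpha>" by (rule incidence_Restr[OF convex_subsetsD(1)[OF \<alpha>]])
      have "continuous_map ?E T (\<lambda>x. ?f x \<alpha> (s, t))" if "s \<in> \<alpha>" "t \<in> \<alpha>" for s t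
        using continuous_map_entry[of s t T] that \<alpha> convex_subsetsD(1)[OF \<alpha>]
        by (auto simp: restriction_family_def)
      moreover have "?f x \<alpha> \<in> carrier N.M" if "x \<in> carrier M" for x
        using f[OF that] \<alpha> unfolding inverse_limit_carrier by blast
      ultimately show ?thesis
        unfolding matrix_topology_def sub_incidence_ring_def N.continuous_map_entry_topology_iff topE
        by blast
    qed
    moreover have "?f x \<in> extensional \<G>" for x by (simp add: restriction_family_def)
    ultimately show "continuous_map ?E ?L (?f \<circ> id)"
      unfolding inverse_limit_topology_def carrL continuous_map_in_subtopology
        continuous_map_componentwise topE using f by auto
  qed (simp only: topE, auto)
  ultimately show ?thesis
    using topX topE by (metis topology_eq topology_finer_continuous_id)
qed

end

theorem theorem3p2:
  fixes P :: "('a, 'm) ring_scheme" and \<Lambda> :: "'l set" and r :: "'l rel"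
  assumes "nontrivial_ring P"
    and "preorder_on \<Lambda> r"
    and "infinite \<Lambda>"
    and "irreducible_proset \<Lambda> r"
    and "locally_finite_rel r"
  shows "let \<G> = finite_convex_subsets \<Lambda> r;
             M = incidence_ring P \<Lambda> r
         in nontrivial_ring M \<and>
            inverse_system_rings \<G> (inclusion_rel \<G>) (sub_incidence_ring P r) matrix_restrict \<and>
            restriction_family \<G> \<in>
              ring_iso M
                (inverse_limit_ring \<G> (inclusion_rel \<G>) (sub_incidence_ring P r) matrix_restrict) \<and>
            (\<forall>T. topological_ring P T \<longrightarrow>
               topological_ring M
                 (pullback_topology (carrier M) (restriction_family \<G>)
                   (inverse_limit_topology \<G> (inclusion_rel \<G>)
                     (matrix_topology P T r) matrix_restrict)))"
proof -
  interpret irreducible_incidence P \<Lambda> r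
    using assms by (auto simp: irreducible_incidence_def incidence_def incidence_axioms_def
        irreducible_incidence_axioms_def nontrivial_ring_def)
  \<comment> \<open>Nonemptiness guarantees that one and zero differ in the matrix ring.\<close>
  have \<Lambda>: "\<Lambda> \<noteq> {}" using assms(3) by auto
  have "topological_ring M (pullback_topology (carrier M) (restriction_family \<G>)
      (inverse_limit_topology \<G> (inclusion_rel \<G>) (matrix_topology P T r) matrix_restrict))"
    if "topological_ring P T" for T
    using topological_ring_entry_topology[OF that \<Lambda>] that
    by (subst pullback_inverse_limit_topology) (auto simp: topological_ring_def)
  moreover have "nontrivial_ring M"
    using assms(1) \<Lambda> by (intro nontrivial_ring_incidence) (auto simp: nontrivial_ring_def)
  ultimately show ?thesis
    unfolding Let_def using inverse_system_incidence restriction_family_ring_iso by blast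
qed

end
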